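(* The probability density function of the variable $\mathbf{R}$ on $R$ (with values in $K'$) resulting from a full non-linear propagation of the probability density of $\mathbf{\Xi}$ is $$p_{\mathbf{R}}(\boldsymbol\rho)=\frac{\exp\left(-\frac{\chi^2(\boldsymbol\rho)}{2}\right)\sqrt{\det C^{\boldsymbol\rho\boldsymbol\rho}(\boldsymbol\rho)}}{\int_{K'}\exp\left(-\frac{\chi^2(\boldsymbol\rho)}{2}\right)\sqrt{\det C^{\boldsymbol\rho\boldsymbol\rho}(\boldsymbol\rho)}\,d\boldsymbol\rho},$$ where $C^{\boldsymbol\rho\boldsymbol\rho}=\Gamma_{\boldsymbol\rho\boldsymbol\rho}^{-1}$ and $\Gamma_{\boldsymbol\rho\boldsymbol\rho}$ is the $2\times2$ restriction of the covariance matrix $\Gamma$ to the $R$ space, evaluated along the Manifold Of Variations at $f_\mu(\boldsymbol\rho)$.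
   Context: Spaces. $A=\mathbb{S}^1\times(-\pi/2,\pi/2)\times\mathbb{R}^2$ (attributables $\mathcal{A}$), $R=\mathbb{R}_{\ge 0}\times\mathbb{R}$ (pairs $\boldsymbol\rho=(\rho,\dot\rho)$), $\mathcal{X}=A\times R$ (orbits $\mathbf{x}=(\mathcal{A},\boldsymbol\rho)$; derivatives are taken in these coordinates, locally identifying $\mathcal{X}$ with a subset of $\mathbb{R}^6$). The residuals space is $\mathbb{R}^m$, $m\ge 6$, and $F:\mathcal{X}\to\mathbb{R}^m$, $\boldsymbol\xi(\mathbf{x})=F(\mathbf{x})$, is the sufficiently smooth map giving the normalised residuals; $Q(\mathbf{x})=\frac1m\boldsymbol\xi(\mathbf{x})^\top\boldsymbol\xi(\mathbf{x})$. Put $B=\frac{\partial F}{\partial\mathbf{x}}$, $B_{\mathcal{A}}=\frac{\partial\boldsymbol\xi}{\partial\mathcal{A}}$, $B_{\boldsymbol\rho}=\frac{\partial\boldsymbol\xi}{\partial\boldsymbol\rho}$, $C_{\mathcal{A}}=B_{\mathcal{A}}^\top B_{\mathcal{A}}$. The normal matrix is the $6\times6$ matrix $C=B^\top B$, and the covariance matrix is $\Gamma=C^{-1}$ ($C$ is invertible at the points of $\mathcal{M}$); $\Gamma_{\boldsymbol\rho\boldsymbol\rho}$ is its $2\times2$ diagonal block corresponding to the $\boldsymbol\rho$ coordinates. Manifold Of Variations. $K'\subseteq R$ is the set of those $\boldsymbol\rho$ (in a given subset $K$ of a compact set of admissible values, the Admissible Region) for which the doubly constrained differential corrections (a Newton-type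 iteration on $\mathcal{A}$ for minimising $Q(\cdot,\boldsymbol\rho)$ with $\boldsymbol\rho$ fixed) converge, to a local minimiser $\mathcal{A}^*(\boldsymbol\rho)$ of $Q(\cdot,\boldsymbol\rho)$. The map $f_\mu(\boldsymbol\rho)=(\mathcal{A}^*(\boldsymbol\rho),\boldsymbol\rho)$ on $K'$ is at least $C^1$, and $\mathcal{M}=f_\mu(K')$ is the Manifold Of Variations. $\chi^2(\boldsymbol\rho)=m\big(Q(f_\mu(\boldsymbol\rho))-Q^*\big)$ with $Q^*=\min_{\boldsymbol\rho\in K'}Q(f_\mu(\boldsymbol\rho))$. Standing approximation: terms containing second derivatives of the residuals multiplied by the residuals themselves are neglected in differentiating the stationarity equation $B_{\mathcal{A}}^\top\boldsymbol\xi=\mathbf{0}$ satisfied at $f_\mu(\boldsymbol\rho)$, so that for all $\boldsymbol\rho\in K'$ $$\frac{\partial\mathcal{A}^*}{\partial\boldsymbol\rho}(\boldsymbol\rho)=-C_{\mathcal{A}}^{-1}B_{\mathcal{A}}^\top B_{\boldsymbol\rho}\quad\text{evaluated at } f_\mu(\boldsymbol\rho).$$ Full non-linear propagation. $\mathbf{\Xi}$ has density $p_{\mathbf{\Xi}}(\boldsymbol\xi)=(2\pi)^{-m/2}\exp(-\frac12\boldsymbol\xi^\top\boldsymbol\xi)$ on $\mathbb{R}^m$. The map $F\circ f_\mu:K'\to V$ is a global parametrization of the 2-dimensional manifold $V=F(\mathcal{M})\subseteq\mathbb{R}^m$. The density of $\mathbf{R}$ is the one obtained from the density on $V$ proportional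 to $p_{\mathbf{\Xi}}|_V$ with respect to the 2-dimensional surface measure of $V$, pulled back to $K'$ through this parametrization $F\circ f_\mu$ (without linearising $F$), and normalised to have integral 1 over $K'$ with respect to $d\boldsymbol\rho$. *)

theory Defs
  imports "HOL-Probability.Probability"
begin

section \<open>Orbits, residuals and the normal matrix\<close>

text \<open>
  An attributable is a quadruple of a right ascension, a declination and their time derivatives; the
  right ascension lives on the circle, which is the unit circle of the complex plane.
\<close>

type_synonym attributable = "complex \<times> real \<times> real \<times> real"
type_synonym orbit = "attributable \<times> (real^2)"

definition attributables :: "attributable set" where
  "attributables = sphere 0 1 \<times> {-pi/2<..<pi/2} \<times> UNIV \<times> UNIV"

definition range_space :: "(real^2) set" where
  "range_space = {\<rho>. 0 \<le> \<rho> $ 1}"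

definition orbits :: "orbit set" where
  "orbits = attributables \<times> range_space"

text \<open>
  Derivatives are taken in the coordinates given by the covering map \<open>orbit_chart\<close>. The index type
  \<open>4 + 2\<close> of the coordinate space has six elements: \<open>Inl i\<close> are the coordinates of the attributable,
  \<open>Inr j\<close> those of the pair (range, range rate).
\<close>

definition attr_chart :: "real^4 \<Rightarrow> attributable" where
  "attr_chart a = (cis (a $ 1), a $ 2, a $ 3, a $ 4)"

definition orbit_chart :: "real^(4+2) \<Rightarrow> orbit" where
  "orbit_chart u = (attr_chart (\<chi> i. u $ Inl i), (\<chi> j. u $ Inr j))"

definition coord_domain :: "(real^(4+2)) set" where
  "coord_domain = orbit_chart -` orbits"

text \<open>
  The Jacobian matrix of \<open>F\<close> at an orbit does not depend on the choice of the determination \<open>u\<close> of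
  its coordinates, because two of them differ by a multiple of \<open>2 * pi\<close> in the first one. On the
  boundary of the orbit space (range equal to zero) the derivative is the one-sided one.
\<close>

definition jacobian :: "(orbit \<Rightarrow> real^'m) \<Rightarrow> orbit \<Rightarrow> real^(4+2)^'m" where
  "jacobian F x = (THE B. \<forall>u. orbit_chart u = x \<longrightarrow>
     ((\<lambda>v. F (orbit_chart v)) has_derivative (\<lambda>h. B *v h)) (at u within coord_domain))"

definition C1_residuals :: "(orbit \<Rightarrow> real^'m) \<Rightarrow> bool" where
  "C1_residuals F \<longleftrightarrow>
     (\<lambda>u. F (orbit_chart u)) differentiable_on coord_domain \<and>
     continuous_on coord_domain (\<lambda>u. jacobian F (orbit_chart u))"

definition jacobian_attr :: "(orbit \<Rightarrow> real^'m) \<Rightarrow> orbit \<Rightarrow> real^4^'m" where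
  "jacobian_attr F x = (\<chi> k i. jacobian F x $ k $ Inl i)"

definition jacobian_rho :: "(orbit \<Rightarrow> real^'m) \<Rightarrow> orbit \<Rightarrow> real^2^'m" where
  "jacobian_rho F x = (\<chi> k j. jacobian F x $ k $ Inr j)"

definition normal_matrix_attr :: "(orbit \<Rightarrow> real^'m) \<Rightarrow> orbit \<Rightarrow> real^4^4" where
  "normal_matrix_attr F x = transpose (jacobian_attr F x) ** jacobian_attr F x"

definition normal_matrix :: "(orbit \<Rightarrow> real^'m) \<Rightarrow> orbit \<Rightarrow> real^(4+2)^(4+2)" where
  "normal_matrix F x = transpose (jacobian F x) ** jacobian F x"

definition covariance :: "(orbit \<Rightarrow> real^'m) \<Rightarrow> orbit \<Rightarrow> real^(4+2)^(4+2)" where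
  "covariance F x = matrix_inv (normal_matrix F x)"

definition covariance_rho :: "(orbit \<Rightarrow> real^'m) \<Rightarrow> orbit \<Rightarrow> real^2^2" where
  "covariance_rho F x = (\<chi> i j. covariance F x $ Inr i $ Inr j)"

definition marginal_normal_matrix :: "(orbit \<Rightarrow> real^'m) \<Rightarrow> orbit \<Rightarrow> real^2^2" where
  "marginal_normal_matrix F x = matrix_inv (covariance_rho F x)"

definition target_Q :: "(orbit \<Rightarrow> real^'m) \<Rightarrow> orbit \<Rightarrow> real" where
  "target_Q F x = (F x \<bullet> F x) / real CARD('m)"


section \<open>The Manifold Of Variations\<close>

text \<open>
  One step of the doubly constrained differential corrections. The gradient of \<open>Q\<close> with respect to
  the attributable is \<open>transpose B\<^sub>A *v \<xi>\<close> up to the factor \<open>2 / m\<close>. The matrix \<open>H\<close> that replaces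
  the Hessian is left arbitrary: \<open>H = normal_matrix_attr F\<close> is the Gauss-Newton choice, and the one
  with the second derivatives of the residuals is the full Newton choice. The step does not depend
  on the determination of the angle.
\<close>

definition dc_step ::
  "(orbit \<Rightarrow> real^'m) \<Rightarrow> (orbit \<Rightarrow> real^4^4) \<Rightarrow> real^2 \<Rightarrow> attributable \<Rightarrow> attributable" where
  "dc_step F H \<rho> a = attr_chart ((SOME u. attr_chart u = a)
     - matrix_inv (H (a, \<rho>)) *v (transpose (jacobian_attr F (a, \<rho>)) *v F (a, \<rho>)))"

definition dc_iterate ::
  "(orbit \<Rightarrow> real^'m) \<Rightarrow> (orbit \<Rightarrow> real^4^4) \<Rightarrow> (real^2 \<Rightarrow> attributable) \<Rightarrow> real^2 \<Rightarrow> nat \<Rightarrow> attributable" where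
  "dc_iterate F H a0 \<rho> n = (dc_step F H \<rho> ^^ n) (a0 \<rho>)"

definition dc_converges_to ::
  "(orbit \<Rightarrow> real^'m) \<Rightarrow> (orbit \<Rightarrow> real^4^4) \<Rightarrow> (real^2 \<Rightarrow> attributable) \<Rightarrow> real^2 \<Rightarrow> attributable \<Rightarrow> bool" where
  "dc_converges_to F H a0 \<rho> a \<longleftrightarrow>
     (\<forall>n. dc_iterate F H a0 \<rho> n \<in> attributables \<and> invertible (H (dc_iterate F H a0 \<rho> n, \<rho>))) \<and>
     dc_iterate F H a0 \<rho> \<longlonglongrightarrow> a"

definition local_minimiser :: "(orbit \<Rightarrow> real^'m) \<Rightarrow> real^2 \<Rightarrow> attributable \<Rightarrow> bool" where
  "local_minimiser F \<rho> a \<longleftrightarrow> a \<in> attributables \<and>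
     (\<exists>e>0. \<forall>b\<in>attributables. dist b a < e \<longrightarrow> target_Q F (a, \<rho>) \<le> target_Q F (b, \<rho>))"

definition mov_domain ::
  "(orbit \<Rightarrow> real^'m) \<Rightarrow> (orbit \<Rightarrow> real^4^4) \<Rightarrow> (real^2 \<Rightarrow> attributable) \<Rightarrow> (real^2) set \<Rightarrow> (real^2) set" where
  "mov_domain F H a0 K =
     {\<rho> \<in> K. \<exists>a. dc_converges_to F H a0 \<rho> a \<and> local_minimiser F \<rho> a}"

definition best_attr ::
  "(orbit \<Rightarrow> real^'m) \<Rightarrow> (orbit \<Rightarrow> real^4^4) \<Rightarrow> (real^2 \<Rightarrow> attributable) \<Rightarrow> real^2 \<Rightarrow> attributable" where
  "best_attr F H a0 \<rho> = lim (dc_iterate F H a0 \<rho>)"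

definition f_mu ::
  "(orbit \<Rightarrow> real^'m) \<Rightarrow> (orbit \<Rightarrow> real^4^4) \<Rightarrow> (real^2 \<Rightarrow> attributable) \<Rightarrow> real^2 \<Rightarrow> orbit" where
  "f_mu F H a0 \<rho> = (best_attr F H a0 \<rho>, \<rho>)"

definition mov ::
  "(orbit \<Rightarrow> real^'m) \<Rightarrow> (orbit \<Rightarrow> real^4^4) \<Rightarrow> (real^2 \<Rightarrow> attributable) \<Rightarrow> (real^2) set \<Rightarrow> orbit set" where
  "mov F H a0 K = f_mu F H a0 ` mov_domain F H a0 K"

text \<open>
  \<open>D\<close> is the derivative at \<open>\<rho>\<close>, relative to \<open>S\<close>, of the map \<open>A\<close> into the space of attributables: the
  derivative of a local lift \<open>a\<close> of \<open>A\<close> to the coordinates. A global lift need not exist on \<open>S\<close>.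
\<close>

definition has_attr_derivative ::
  "(real^2 \<Rightarrow> attributable) \<Rightarrow> real^2^4 \<Rightarrow> real^2 \<Rightarrow> (real^2) set \<Rightarrow> bool" where
  "has_attr_derivative A D \<rho> S \<longleftrightarrow>
     (\<exists>a. attr_chart (a \<rho>) = A \<rho> \<and> (\<forall>\<^sub>F r in at \<rho> within S. attr_chart (a r) = A r) \<and>
          (a has_derivative (\<lambda>h. D *v h)) (at \<rho> within S))"

definition chi_sq ::
  "(orbit \<Rightarrow> real^'m) \<Rightarrow> (real^2 \<Rightarrow> orbit) \<Rightarrow> real \<Rightarrow> real^2 \<Rightarrow> real" where
  "chi_sq F f Qstar \<rho> = real CARD('m) * (target_Q F (f \<rho>) - Qstar)"


section \<open>Surface measure and density of the residuals\<close>

text \<open>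
  \<open>J\<close> is the Jacobian matrix of \<open>\<psi>\<close>. The parameter domain \<open>W\<close> need not be open (it may for instance
  be compact), so that derivatives are relative to \<open>W\<close>; they are unique at almost all points of \<open>W\<close>.
\<close>

definition regular_parametrization ::
  "(real^2) set \<Rightarrow> (real^2 \<Rightarrow> real^'m) \<Rightarrow> (real^2 \<Rightarrow> real^2^'m) \<Rightarrow> (real^'m) set \<Rightarrow> bool" where
  "regular_parametrization W \<psi> J V \<longleftrightarrow>
     W \<in> sets borel \<and> (\<exists>\<phi>. homeomorphism W V \<psi> \<phi>) \<and> continuous_on W J \<and>
     (\<forall>u\<in>W. (\<psi> has_derivative (\<lambda>h. J u *v h)) (at u within W) \<and> rank (J u) = 2)"

text \<open>
  The two-dimensional surface measure of a surface \<open>V\<close> that admits a global parametrization, as a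
  Borel measure on the ambient space: in each parametrization, the area element is the square root
  of the Gram determinant. By the change of variables formula, the measure obtained is the same for
  all parametrizations of \<open>V\<close>.
\<close>

definition surface_measure :: "(real^'m) set \<Rightarrow> (real^'m) measure" where
  "surface_measure V = (THE \<sigma>. \<forall>W \<psi> J. regular_parametrization W \<psi> J V \<longrightarrow>
     \<sigma> = distr (density (restrict_space lborel W)
                  (\<lambda>u. ennreal (sqrt (det (transpose (J u) ** J u))))) borel \<psi>)"

definition p_Xi :: "real^'m \<Rightarrow> real" where
  "p_Xi \<xi> = (2 * pi) powr (- real CARD('m) / 2) * exp (- (\<xi> \<bullet> \<xi>) / 2)"

end

(*
  The residual surface V is parametrized by K' through F o f. The standing approximation makes the
  columns of its Jacobian J = B_A dA + B_rho orthogonal to those of B_A; hence, with E = [dA; I],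
  C E = B^T J = [0; J^T J], and multiplying by the covariance matrix gives
  Gamma_rho_rho (J^T J) = I. The area element sqrt (det (J^T J)) is therefore
  sqrt (det C^rho_rho), and p_Xi along V is a constant times exp (- chi^2 / 2).

  The parameter domain is only a Borel set, so derivatives relative to it are unique only almost
  everywhere; this suffices for the surface measure to be independent of the parametrization.
*)

theory Submission
  imports Defs
begin

text \<open>Under the standing approximation \<open>J\<close> is the part of B_rho orthogonal to the
  columns of B_A, so its Gram matrix is the Schur complement of C_A in C. This is why the area
  element sees the inverse of a block of the covariance matrix, and not a block of C itself. The
  surface measure is given by a description, which has a usable value only once any two
  parametrizations of V are known to yield one measure. Two Jacobian matrices of the same map may
  differ on a null set, so the one in the parametrization hypothesis is never compared with
  \<open>J\<close>: it is \<open>J\<close> that is shown to satisfy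
  \<open>regular_parametrization\<close>, and uniqueness of the measure does the rest. The right
  ascension lives on a circle, so derivatives pass through lifts to coordinates. Along the manifold
  such lifts may exist only locally, and differentiability is therefore treated at one point at a
  time. No constant is evaluated: \<open>c\<close>, the power of 2 pi and \<open>Qstar\<close> merge
  into one factor, fixed at the end by total probability one.\<close>

section \<open>Differentiation and integration relative to sets that need not be open\<close>

text \<open>
  Where two relative derivatives of \<open>g\<close> differ, the identity has a singular derivative relative to the
  set of these points, which is negligible by Sard's theorem.
\<close>

lemma negligible_distinct_derivatives:
  fixes g :: "real^'n::{finite,wellorder} \<Rightarrow> 'b::real_inner"
  assumes A: "\<And>x. x \<in> S \<Longrightarrow> (g has_derivative A x) (at x within S)"
    and B: "\<And>x. x \<in> S \<Longrightarrow> (g has_derivative B x) (at x within S)"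
  shows "negligible {x \<in> S. A x \<noteq> B x}"
proof -
  define N where "N = {x \<in> S. A x \<noteq> B x}"
  have "\<exists>f'. ((\<lambda>y. y) has_derivative f') (at x within N) \<and> rank (matrix f') < CARD('n)" if "x \<in> N" for x
  proof -
    obtain v where v: "A x v \<noteq> B x v" using \<open>x \<in> N\<close> by (auto simp: N_def)
    define w where "w = A x v - B x v"
    \<comment> \<open>Dividing \<open>w\<close> by its squared length gives \<open>d v = 1\<close>.
      Subtracting the zero map \<open>g y - g y\<close>, paired with this vector, in the direction
      \<open>v\<close> does not change the identity, but gives it a derivative that annihilates
      \<open>v\<close>.\<close>
    define d where "d h = inner (A x h - B x h) (w /\<^sub>R inner w w)" for h
    have ww: "inner w w \<noteq> 0" using v by (simp add: w_def)
    have S: "x \<in> S" "N \<subseteq> S" using \<open>x \<in> N\<close> by (auto simp: N_def)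
    have "((\<lambda>y. g y - g y) has_derivative (\<lambda>h. A x h - B x h)) (at x within N)"
      by (intro has_derivative_diff has_derivative_subset[OF A] has_derivative_subset[OF B] S)
    from has_derivative_inner_left[OF this, of "w /\<^sub>R inner w w"]
    have "((\<lambda>y. y - inner (g y - g y) (w /\<^sub>R inner w w) *\<^sub>R v) has_derivative (\<lambda>h. h - d h *\<^sub>R v)) (at x within N)"
      unfolding d_def by (intro has_derivative_diff has_derivative_ident has_derivative_scaleR_left)
    then have der: "((\<lambda>y. y) has_derivative (\<lambda>h. h - d h *\<^sub>R v)) (at x within N)" by simp
    have lin: "linear (\<lambda>h. h - d h *\<^sub>R v)" using der by (rule has_derivative_linear)
    have "d v = 1" using ww by (simp add: d_def w_def)
    have "v \<noteq> 0"
    proof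
      assume "v = 0"
      then have "A x v = 0" "B x v = 0"
        using has_derivative_linear[OF A[OF S(1)]] has_derivative_linear[OF B[OF S(1)]] by (auto simp: linear_0)
      then show False using v by simp
    qed
    have "matrix (\<lambda>h. h - d h *\<^sub>R v) *v v = 0"
      using \<open>d v = 1\<close> lin by (simp add: matrix_works)
    then have "matrix (\<lambda>h. h - d h *\<^sub>R v) *v v = matrix (\<lambda>h. h - d h *\<^sub>R v) *v 0"
      by (simp only: matrix_vector_mult_0_right)
    then have "\<not> inj ((*v) (matrix (\<lambda>h. h - d h *\<^sub>R v)))"
      using \<open>v \<noteq> 0\<close> by (meson injD)
    then show ?thesis using der by (auto simp: less_rank_noninjective)
  qed
  then obtain f' where "\<And>x. x \<in> N \<Longrightarrow> ((\<lambda>y. y) has_derivative f' x) (at x within N)"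
    "\<And>x. x \<in> N \<Longrightarrow> rank (matrix (f' x)) < CARD('n)"
    by metis
  then have "negligible ((\<lambda>y. y) ` N)"
    by (intro baby_Sard) auto
  then show ?thesis by (simp add: N_def)
qed

lemma nn_integral_lebesgue_on_eq_integral:
  fixes f :: "'a::euclidean_space \<Rightarrow> real"
  assumes "S \<in> sets lebesgue" "f absolutely_integrable_on S" "\<And>x. x \<in> S \<Longrightarrow> 0 \<le> f x"
  shows "(\<integral>\<^sup>+x\<in>S. ennreal (f x) \<partial>lborel) = ennreal (integral S f)"
proof -
  have "set_integrable lebesgue S f" using assms by simp
  then have "integrable lebesgue (\<lambda>x. indicator S x * f x)" by (simp add: set_integrable_def)
  then have "(\<integral>\<^sup>+x. ennreal (indicator S x * f x) \<partial>lebesgue) = ennreal (LINT x|lebesgue. indicator S x * f x)"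
    by (rule nn_integral_eq_integral) (auto simp: indicator_def assms)
  also have "(LINT x|lebesgue. indicator S x * f x) = integral S f"
    using set_lebesgue_integral_eq_integral(2)[OF \<open>set_integrable lebesgue S f\<close>]
    by (simp add: set_lebesgue_integral_def)
  also have "(\<integral>\<^sup>+x. ennreal (indicator S x * f x) \<partial>lebesgue) = (\<integral>\<^sup>+x\<in>S. ennreal (f x) \<partial>lebesgue)"
    by (intro nn_integral_cong) (auto simp: indicator_def)
  finally show ?thesis by (simp add: nn_integral_completion)
qed

lemma absolutely_integrable_if_nn_integral_finite:
  fixes f :: "'a::euclidean_space \<Rightarrow> real"
  assumes S: "S \<in> sets lebesgue" and f: "f \<in> borel_measurable (lebesgue_on S)"
    and pos: "\<And>x. x \<in> S \<Longrightarrow> 0 \<le> f x"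
    and fin: "(\<integral>\<^sup>+x\<in>S. ennreal (f x) \<partial>lborel) < \<infinity>"
  shows "f absolutely_integrable_on S"
proof -
  have "(\<integral>\<^sup>+x. ennreal (indicator S x * f x) \<partial>lebesgue) = (\<integral>\<^sup>+x\<in>S. ennreal (f x) \<partial>lborel)"
    unfolding nn_integral_completion[of lborel, symmetric] by (intro nn_integral_cong) (auto simp: indicator_def)
  moreover have "(\<lambda>x. indicator S x * f x) \<in> borel_measurable lebesgue"
    using f S by (simp add: borel_measurable_restrict_space_iff)
  ultimately have "integrable lebesgue (\<lambda>x. indicator S x * f x)"
    using fin by (intro integrableI_nonneg) (auto simp: indicator_def pos)
  then show ?thesis by (simp add: set_integrable_def)
qed

text \<open>The formula for absolutely integrable functions also transfers integrability in both
  directions. Hence for nonnegative \<open>f\<close> the remaining case is the one where both sides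
  are infinite, and surfaces of infinite area are covered.\<close>

lemma nn_integral_change_of_variables:
  fixes f :: "real^'n::{finite,wellorder} \<Rightarrow> real" and g :: "real^'n::_ \<Rightarrow> real^'n::_"
  assumes S: "S \<in> sets lebesgue" and T: "g ` S \<in> sets lebesgue"
    and der: "\<And>x. x \<in> S \<Longrightarrow> (g has_derivative g' x) (at x within S)"
    and inj: "inj_on g S"
    and f: "f \<in> borel_measurable (lebesgue_on (g ` S))"
    and h: "(\<lambda>x. \<bar>det (matrix (g' x))\<bar> * f (g x)) \<in> borel_measurable (lebesgue_on S)"
    and pos: "\<And>y. y \<in> g ` S \<Longrightarrow> 0 \<le> f y"
  shows "(\<integral>\<^sup>+x\<in>S. ennreal (\<bar>det (matrix (g' x))\<bar> * f (g x)) \<partial>lborel) = (\<integral>\<^sup>+y\<in>g ` S. ennreal (f y) \<partial>lborel)"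
proof -
  let ?h = "\<lambda>x. \<bar>det (matrix (g' x))\<bar> * f (g x)"
  have cov: "?h absolutely_integrable_on S \<and> integral S ?h = b \<longleftrightarrow>
      f absolutely_integrable_on g ` S \<and> integral (g ` S) f = b" for b
  proof -
    \<comment> \<open>The change of variables theorem is about vector-valued integrands; scalars
      enter it as vectors of dimension one.\<close>
    have "(\<lambda>x. \<bar>det (matrix (g' x))\<bar> *\<^sub>R (vec (f (g x)) :: real^1)) absolutely_integrable_on S \<and>
        integral S (\<lambda>x. \<bar>det (matrix (g' x))\<bar> *\<^sub>R (vec (f (g x)) :: real^1)) = vec b \<longleftrightarrow>
      (\<lambda>y. vec (f y) :: real^1) absolutely_integrable_on g ` S \<and> integral (g ` S) (\<lambda>y. vec (f y) :: real^1) = vec b"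
      by (rule has_absolute_integral_change_of_variables[OF S der inj])
    moreover have "(\<lambda>x. \<bar>det (matrix (g' x))\<bar> *\<^sub>R (vec (f (g x)) :: real^1)) = (\<lambda>x. vec (?h x))"
      by (auto simp: vec_eq_iff)
    ultimately show ?thesis
      by (auto simp: absolutely_integrable_on_1_iff integral_on_1_eq absolutely_integrable_on_def integrable_on_1_iff)
  qed
  have pos': "x \<in> S \<Longrightarrow> 0 \<le> ?h x" for x using pos by auto
  show ?thesis
  proof (cases "f absolutely_integrable_on g ` S")
    case True
    with cov have "?h absolutely_integrable_on S" "integral S ?h = integral (g ` S) f" by auto
    then show ?thesis
      by (subst (1 2) nn_integral_lebesgue_on_eq_integral) (auto simp: True S T pos intro: pos')
  next
    case False
    with cov have "\<not> ?h absolutely_integrable_on S" by auto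
    with absolutely_integrable_if_nn_integral_finite[OF S h pos']
    have "(\<integral>\<^sup>+x\<in>S. ennreal (?h x) \<partial>lborel) = \<infinity>" by (auto simp: less_top[symmetric])
    moreover from False absolutely_integrable_if_nn_integral_finite[OF T f pos]
    have "(\<integral>\<^sup>+y\<in>g ` S. ennreal (f y) \<partial>lborel) = \<infinity>" by (auto simp: less_top[symmetric])
    ultimately show ?thesis by simp
  qed
qed

text \<open>Applying \<open>g'\<close> to the linearisation error of \<open>f\<close> at
  \<open>x\<close> yields the linearisation error of \<open>g\<close> up to sign. A left inverse of
  \<open>f'\<close> is enough, so the target may have larger dimension, as for a surface in the
  residuals space; any choice of \<open>g'\<close> off the range of \<open>f'\<close> will
  do.\<close>

lemma has_derivative_left_inverse:
  fixes f :: "'a::real_normed_vector \<Rightarrow> 'b::real_normed_vector"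
  assumes f: "(f has_derivative f') (at x within S)" and "x \<in> S"
    and g': "bounded_linear g'" "\<And>h. g' (f' h) = h"
    and g: "\<And>z. z \<in> S \<Longrightarrow> g (f z) = z"
    and cont: "continuous (at (f x) within f ` S) g"
  shows "(g has_derivative g') (at (f x) within f ` S)"
proof -
  interpret g': bounded_linear g' by fact
  obtain C where C: "C > 0" "\<And>y. norm (g' y) \<le> norm y * C" using g'.pos_bounded by blast
  show ?thesis
    unfolding has_derivative_within_alt
  proof (intro conjI allI impI g'(1))
    fix e :: real assume e: "e > 0"
    \<comment> \<open>The first bound makes the error at most half of \<open>norm (z - x)\<close>,
      which gives \<open>norm (z - x) \<le> 2 * C * norm (y - f x)\<close>; inserting this, the
      second bound brings the error below \<open>e * norm (y - f x)\<close>.\<close>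
    define k where "k = min (1 / (2 * C)) (e / (2 * C * C))"
    have k: "k > 0" "k * C \<le> 1/2" "2 * C * C * k \<le> e"
      using C(1) e by (auto simp: k_def field_simps min_def)
    obtain d where d: "d > 0"
      "\<And>z. z \<in> S \<Longrightarrow> norm (z - x) < d \<Longrightarrow> norm (f z - f x - f' (z - x)) \<le> k * norm (z - x)"
      using f k(1) unfolding has_derivative_within_alt by meson
    obtain d' where d': "d' > 0" "\<And>y. y \<in> f ` S \<Longrightarrow> dist y (f x) < d' \<Longrightarrow> dist (g y) (g (f x)) < d"
      using cont \<open>d > 0\<close> unfolding continuous_within_eps_delta by (metis)
    have "norm (g y - g (f x) - g' (y - f x)) \<le> e * norm (y - f x)"
      if y: "y \<in> f ` S" "norm (y - f x) < d'" for y
    proof -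
      obtain z where z: "z \<in> S" "y = f z" using y by blast
      have "norm (z - x) < d" using d'(2)[OF y(1)] y(2) z g \<open>x \<in> S\<close> by (simp add: dist_norm)
      then have "norm (f z - f x - f' (z - x)) \<le> k * norm (z - x)" using d(2) z by simp
      then have "norm (f z - f x - f' (z - x)) * C \<le> k * norm (z - x) * C"
        using C(1) by (intro mult_right_mono) auto
      then have 1: "norm (g' (f z - f x - f' (z - x))) \<le> C * k * norm (z - x)"
        using C(2)[of "f z - f x - f' (z - x)"] by (simp add: mult_ac)
      have 2: "g' (f z - f x - f' (z - x)) = g' (y - f x) - (z - x)"
        by (simp add: g'.diff g'(2) z)
      have "norm (z - x) \<le> norm (g' (y - f x)) + norm (g' (y - f x) - (z - x))"
        by (metis norm_triangle_sub norm_minus_commute)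
      also have "\<dots> \<le> norm (y - f x) * C + (1/2) * norm (z - x)"
        using C(2)[of "y - f x"] 1 mult_right_mono[OF k(2), of "norm (z - x)"] unfolding 2 by (simp add: mult_ac)
      finally have "norm (z - x) \<le> 2 * C * norm (y - f x)" by (simp add: field_simps)
      then have "C * k * norm (z - x) \<le> C * k * (2 * C * norm (y - f x))"
        using C(1) k(1) by (intro mult_left_mono) auto
      also have "\<dots> \<le> e * norm (y - f x)"
        using mult_right_mono[OF k(3), of "norm (y - f x)"] by (simp add: mult_ac)
      finally have "norm (g' (y - f x) - (z - x)) \<le> e * norm (y - f x)" using 1 unfolding 2 by linarith
      then show ?thesis using z g \<open>x \<in> S\<close> by (simp add: norm_minus_commute)
    qed
    then show "\<exists>d>0. \<forall>y\<in>f ` S. norm (y - f x) < d \<longrightarrow> norm (g y - g (f x) - g' (y - f x)) \<le> e * norm (y - f x)"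
      using d'(1) by blast
  qed
qed

section \<open>The area element and the surface measure\<close>

definition area_density :: "(real^2 \<Rightarrow> real^2^'m) \<Rightarrow> real^2 \<Rightarrow> real" where
  "area_density J u = sqrt (det (transpose (J u) ** J u))"

lemma det_gram_nonneg: "0 \<le> det (transpose A ** (A :: real^2^'m))"
proof -
  have "(\<Sum>k\<in>UNIV. A $ k $ 1 * A $ k $ 2)\<^sup>2 \<le> (\<Sum>k\<in>UNIV. (A $ k $ 1)\<^sup>2) * (\<Sum>k\<in>UNIV. (A $ k $ 2)\<^sup>2)"
    by (rule Cauchy_Schwarz_ineq_sum)
  then show ?thesis
    by (simp add: det_2 matrix_matrix_mult_def transpose_def power2_eq_square mult.commute)
qed

lemma area_density_nonneg: "0 \<le> area_density J u"
  by (simp add: area_density_def det_gram_nonneg)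

lemma continuous_on_area_density:
  "continuous_on W J \<Longrightarrow> continuous_on W (area_density J)"
  unfolding area_density_def det_2 matrix_matrix_mult_def transpose_def vec_lambda_beta
  by (intro continuous_intros)

lemma sqrt_det_gram_mult:
  fixes A :: "real^2^'m" and T :: "real^2^2"
  shows "sqrt (det (transpose (A ** T) ** (A ** T))) = \<bar>det T\<bar> * sqrt (det (transpose A ** A))"
proof -
  have "transpose (A ** T) ** (A ** T) = transpose T ** (transpose A ** A) ** T"
    by (simp add: matrix_transpose_mul matrix_mul_assoc)
  then have "det (transpose (A ** T) ** (A ** T)) = (det T)\<^sup>2 * det (transpose A ** A)"
    by (simp add: det_mul det_transpose power2_eq_square)
  then show ?thesis by (simp add: real_sqrt_mult)
qed

lemma rank_eq_2_left_inverse: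
  fixes A :: "real^2^'m"
  assumes "rank A = 2"
  obtains L where "L ** A = mat 1"
  using assms full_rank_injective[of A] matrix_left_invertible_injective[of A] by auto

definition area_measure :: "(real^2) set \<Rightarrow> (real^2 \<Rightarrow> real^'m) \<Rightarrow> (real^2 \<Rightarrow> real^2^'m) \<Rightarrow> (real^'m) measure" where
  "area_measure W \<psi> J = distr (density (restrict_space lborel W) (\<lambda>u. ennreal (area_density J u))) borel \<psi>"

lemma nn_integral_area_measure:
  assumes W: "W \<in> sets borel" and \<psi>: "continuous_on W \<psi>" and J: "continuous_on W J"
    and g: "g \<in> borel_measurable borel"
  shows "(\<integral>\<^sup>+\<xi>. g \<xi> \<partial>area_measure W \<psi> J) = (\<integral>\<^sup>+u\<in>W. ennreal (area_density J u) * g (\<psi> u) \<partial>lborel)"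
proof -
  have "area_density J \<in> borel_measurable (restrict_space lborel W)"
    using borel_measurable_continuous_on_restrict[OF continuous_on_area_density[OF J]]
    by (simp add: measurable_def sets_restrict_space space_restrict_space)
  then have m: "(\<lambda>u. ennreal (area_density J u)) \<in> borel_measurable (restrict_space lborel W)"
    by simp
  have m': "\<psi> \<in> measurable (restrict_space lborel W) borel"
    using borel_measurable_continuous_on_restrict[OF \<psi>]
    by (simp add: measurable_def sets_restrict_space space_restrict_space)
  have "(\<integral>\<^sup>+\<xi>. g \<xi> \<partial>area_measure W \<psi> J) =
      (\<integral>\<^sup>+u. g (\<psi> u) \<partial>density (restrict_space lborel W) (\<lambda>u. ennreal (area_density J u)))"
    unfolding area_measure_def using m' g by (intro nn_integral_distr) auto
  also have "\<dots> = (\<integral>\<^sup>+u. ennreal (area_density J u) * g (\<psi> u) \<partial>restrict_space lborel W)"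
    using m m' g by (intro nn_integral_density) auto
  also have "\<dots> = (\<integral>\<^sup>+u\<in>W. ennreal (area_density J u) * g (\<psi> u) \<partial>lborel)"
    using W by (intro nn_integral_restrict_space) auto
  finally show ?thesis .
qed

lemma AE_notin_negligible: "negligible N \<Longrightarrow> AE x in lborel. x \<notin> N"
  unfolding negligible_iff_null_sets by (drule AE_not_in) (simp add: AE_completion_iff)

text \<open>Almost everywhere \<open>J\<^sub>1 u\<close> factors as
  \<open>J\<^sub>2 (\<tau> u) ** T u\<close>, with \<tau> the transition map between the parameter
  domains and \<open>T\<close> its derivative. The area elements then differ by the factor
  \<open>\<bar>det (T u)\<bar>\<close>, which is the one that the change of variables along \<tau>
  introduces.\<close>

lemma area_measure_unique:
  fixes \<psi>\<^sub>1 \<psi>\<^sub>2 :: "real^2 \<Rightarrow> real^'m"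
  assumes 1: "regular_parametrization W\<^sub>1 \<psi>\<^sub>1 J\<^sub>1 V" and 2: "regular_parametrization W\<^sub>2 \<psi>\<^sub>2 J\<^sub>2 V"
  shows "area_measure W\<^sub>1 \<psi>\<^sub>1 J\<^sub>1 = area_measure W\<^sub>2 \<psi>\<^sub>2 J\<^sub>2"
proof -
  obtain \<phi>\<^sub>1 where h1: "homeomorphism W\<^sub>1 V \<psi>\<^sub>1 \<phi>\<^sub>1" using 1 by (auto simp: regular_parametrization_def)
  obtain \<phi>\<^sub>2 where h2: "homeomorphism W\<^sub>2 V \<psi>\<^sub>2 \<phi>\<^sub>2" using 2 by (auto simp: regular_parametrization_def)
  have W: "W\<^sub>1 \<in> sets borel" "W\<^sub>2 \<in> sets borel" and J: "continuous_on W\<^sub>1 J\<^sub>1" "continuous_on W\<^sub>2 J\<^sub>2"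
    and d1: "u \<in> W\<^sub>1 \<Longrightarrow> (\<psi>\<^sub>1 has_derivative (\<lambda>h. J\<^sub>1 u *v h)) (at u within W\<^sub>1)"
    and d2: "w \<in> W\<^sub>2 \<Longrightarrow> (\<psi>\<^sub>2 has_derivative (\<lambda>h. J\<^sub>2 w *v h)) (at w within W\<^sub>2)"
    and r: "w \<in> W\<^sub>2 \<Longrightarrow> rank (J\<^sub>2 w) = 2" for u w
    using 1 2 by (auto simp: regular_parametrization_def)
  have \<psi>: "continuous_on W\<^sub>1 \<psi>\<^sub>1" "continuous_on W\<^sub>2 \<psi>\<^sub>2" "\<psi>\<^sub>1 ` W\<^sub>1 = V" "\<psi>\<^sub>2 ` W\<^sub>2 = V"
    "\<phi>\<^sub>1 ` V = W\<^sub>1" "\<phi>\<^sub>2 ` V = W\<^sub>2" "continuous_on V \<phi>\<^sub>2"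
    "\<And>y. y \<in> V \<Longrightarrow> \<psi>\<^sub>2 (\<phi>\<^sub>2 y) = y" "\<And>y. y \<in> V \<Longrightarrow> \<psi>\<^sub>1 (\<phi>\<^sub>1 y) = y"
    "\<And>u. u \<in> W\<^sub>1 \<Longrightarrow> \<phi>\<^sub>1 (\<psi>\<^sub>1 u) = u" "\<And>u. u \<in> W\<^sub>2 \<Longrightarrow> \<phi>\<^sub>2 (\<psi>\<^sub>2 u) = u"
    using h1 h2 by (auto simp: homeomorphism_def)
  have "\<forall>w\<in>W\<^sub>2. \<exists>L. L ** J\<^sub>2 w = mat 1" using r rank_eq_2_left_inverse by metis
  then obtain L where L: "\<And>w. w \<in> W\<^sub>2 \<Longrightarrow> L w ** J\<^sub>2 w = mat 1" by metis
  define \<tau> where "\<tau> u = \<phi>\<^sub>2 (\<psi>\<^sub>1 u)" for u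
  \<comment> \<open>The chain rule for \<tau>, with the left inverse of \<open>J\<^sub>2\<close>
    serving as the derivative of \<open>\<phi>\<^sub>2\<close> relative to \<open>V\<close>.\<close>
  define T where "T u = L (\<tau> u) ** J\<^sub>1 u" for u
  have \<tau>W: "\<tau> ` W\<^sub>1 = W\<^sub>2" unfolding \<tau>_def using \<psi>(3,6) by (metis image_image)
  have \<tau>in: "u \<in> W\<^sub>1 \<Longrightarrow> \<tau> u \<in> W\<^sub>2" for u using \<tau>W by blast
  have \<psi>\<tau>: "u \<in> W\<^sub>1 \<Longrightarrow> \<psi>\<^sub>2 (\<tau> u) = \<psi>\<^sub>1 u" for u unfolding \<tau>_def using \<psi> by auto
  have inj: "inj_on \<tau> W\<^sub>1" using \<psi>\<tau> \<psi>(10) by (metis inj_onI)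
  have d\<tau>: "(\<tau> has_derivative (\<lambda>h. T u *v h)) (at u within W\<^sub>1)" if u: "u \<in> W\<^sub>1" for u
  proof -
    have "(\<phi>\<^sub>2 has_derivative (\<lambda>y. L (\<tau> u) *v y)) (at (\<psi>\<^sub>2 (\<tau> u)) within \<psi>\<^sub>2 ` W\<^sub>2)"
    proof (rule has_derivative_left_inverse[OF d2[OF \<tau>in[OF u]]])
      show "continuous (at (\<psi>\<^sub>2 (\<tau> u)) within \<psi>\<^sub>2 ` W\<^sub>2) \<phi>\<^sub>2"
        using \<psi> u by (auto simp: continuous_on_eq_continuous_within \<psi>\<tau>)
    qed (use \<tau>in[OF u] L \<psi> in \<open>auto simp: matrix_vector_mul_assoc\<close>)
    then have "(\<phi>\<^sub>2 has_derivative (\<lambda>y. L (\<tau> u) *v y)) (at (\<psi>\<^sub>1 u) within \<psi>\<^sub>1 ` W\<^sub>1)"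
      using \<psi>\<tau> u \<psi> by simp
    from diff_chain_within[OF d1[OF u] this]
    show ?thesis by (simp add: o_def \<tau>_def[symmetric] T_def matrix_vector_mul_assoc)
  qed
  have cont_\<tau>: "continuous_on W\<^sub>1 \<tau>"
    using d\<tau> continuous_on_eq_continuous_within has_derivative_continuous by blast
  define N where "N = {u \<in> W\<^sub>1. (\<lambda>h. J\<^sub>1 u *v h) \<noteq> (\<lambda>h. J\<^sub>2 (\<tau> u) *v (T u *v h))}"
  have "negligible N"
    unfolding N_def
  proof (rule negligible_distinct_derivatives[OF d1])
    fix u assume u: "u \<in> W\<^sub>1"
    have "(\<psi>\<^sub>2 has_derivative (\<lambda>h. J\<^sub>2 (\<tau> u) *v h)) (at (\<tau> u) within \<tau> ` W\<^sub>1)"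
      using d2 \<tau>in[OF u] \<tau>W by simp
    from diff_chain_within[OF d\<tau>[OF u] this]
    have "((\<psi>\<^sub>2 \<circ> \<tau>) has_derivative (\<lambda>h. J\<^sub>2 (\<tau> u) *v (T u *v h))) (at u within W\<^sub>1)"
      by (simp add: o_def)
    then show "(\<psi>\<^sub>1 has_derivative (\<lambda>h. J\<^sub>2 (\<tau> u) *v (T u *v h))) (at u within W\<^sub>1)"
      by (rule has_derivative_transform[OF u, rotated]) (simp add: \<psi>\<tau>)
  qed
  then have AE: "AE u in lborel. u \<notin> N" by (rule AE_notin_negligible)
  have J12: "area_density J\<^sub>1 u = \<bar>det (T u)\<bar> * area_density J\<^sub>2 (\<tau> u)" if "u \<in> W\<^sub>1" "u \<notin> N" for u
  proof -
    have "J\<^sub>1 u *v h = (J\<^sub>2 (\<tau> u) ** T u) *v h" for h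
      using that by (auto simp: N_def matrix_vector_mul_assoc dest: fun_cong)
    then have "J\<^sub>1 u = J\<^sub>2 (\<tau> u) ** T u" by (simp add: matrix_eq)
    then show ?thesis by (simp add: area_density_def sqrt_det_gram_mult)
  qed
  have leb: "W\<^sub>1 \<in> sets lebesgue" "W\<^sub>2 \<in> sets lebesgue" using W by auto
  have ind: "(\<lambda>u. indicat_real B (\<psi> u)) \<in> borel_measurable (lebesgue_on W)"
    if "B \<in> sets borel" "continuous_on W \<psi>" "W \<in> sets lebesgue" for B :: "(real^'m) set" and \<psi> :: "real^2 \<Rightarrow> real^'m" and W
    using continuous_imp_measurable_on_sets_lebesgue[OF that(2,3)] that(1) by measurable
  show ?thesis
  proof (rule measure_eqI)
    show "sets (area_measure W\<^sub>1 \<psi>\<^sub>1 J\<^sub>1) = sets (area_measure W\<^sub>2 \<psi>\<^sub>2 J\<^sub>2)" by (simp add: area_measure_def)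
    fix B assume "B \<in> sets (area_measure W\<^sub>1 \<psi>\<^sub>1 J\<^sub>1)"
    then have B: "B \<in> sets borel" by (simp add: area_measure_def)
    define f where "f w = indicat_real B (\<psi>\<^sub>2 w) * area_density J\<^sub>2 w" for w
    have em: "emeasure (area_measure W \<psi> J) B = (\<integral>\<^sup>+u\<in>W. ennreal (indicat_real B (\<psi> u) * area_density J u) \<partial>lborel)"
      if "W \<in> sets borel" "continuous_on W \<psi>" "continuous_on W J" for W J and \<psi> :: "real^2 \<Rightarrow> real^'m"
    proof -
      have "emeasure (area_measure W \<psi> J) B = (\<integral>\<^sup>+\<xi>. indicator B \<xi> \<partial>area_measure W \<psi> J)"
        using B by (intro nn_integral_indicator[symmetric]) (simp add: area_measure_def)
      also have "\<dots> = (\<integral>\<^sup>+u\<in>W. ennreal (area_density J u) * indicator B (\<psi> u) \<partial>lborel)"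
        using that B by (intro nn_integral_area_measure) auto
      finally show ?thesis
        by (auto intro!: nn_integral_cong split: split_indicator simp: indicator_def)
    qed
    have "emeasure (area_measure W\<^sub>1 \<psi>\<^sub>1 J\<^sub>1) B = (\<integral>\<^sup>+u\<in>W\<^sub>1. ennreal (indicat_real B (\<psi>\<^sub>1 u) * area_density J\<^sub>1 u) \<partial>lborel)"
      by (rule em) fact+
    also have "\<dots> = (\<integral>\<^sup>+u\<in>W\<^sub>1. ennreal (\<bar>det (matrix (\<lambda>h. T u *v h))\<bar> * f (\<tau> u)) \<partial>lborel)"
      by (rule nn_integral_cong_AE, rule AE_mp[OF AE])
        (auto simp: f_def J12 \<psi>\<tau> indicator_def mult_ac)
    also have "\<dots> = (\<integral>\<^sup>+w\<in>\<tau> ` W\<^sub>1. ennreal (f w) \<partial>lborel)"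
    proof (rule nn_integral_change_of_variables[OF leb(1) _ d\<tau> inj])
      show "f \<in> borel_measurable (lebesgue_on (\<tau> ` W\<^sub>1))"
        unfolding \<tau>W f_def using leb(2)
        by (intro borel_measurable_times ind B \<psi>(2) continuous_imp_measurable_on_sets_lebesgue continuous_on_area_density J)
      \<comment> \<open>Lebesgue measurability does not survive composition with \<tau>, so both
        factors are treated as composites with continuous maps on \<open>W\<^sub>1\<close>.\<close>
      have "(\<lambda>u. f (\<tau> u)) \<in> borel_measurable (lebesgue_on W\<^sub>1)"
        unfolding f_def using leb(1)
        by (intro borel_measurable_times ind B continuous_imp_measurable_on_sets_lebesgue
              continuous_on_compose2[OF continuous_on_area_density[OF J(2)] cont_\<tau>]
              continuous_on_compose2[OF \<psi>(2) cont_\<tau>]) (auto simp: \<tau>W)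
      then show "(\<lambda>u. \<bar>det (matrix (\<lambda>h. T u *v h))\<bar> * f (\<tau> u)) \<in> borel_measurable (lebesgue_on W\<^sub>1)"
        by (intro borel_measurable_times borel_measurable_abs borel_measurable_det_Jacobian[OF leb(1) d\<tau>])
    qed (auto simp: \<tau>W leb f_def area_density_nonneg)
    also have "\<dots> = emeasure (area_measure W\<^sub>2 \<psi>\<^sub>2 J\<^sub>2) B"
      unfolding \<tau>W f_def by (rule em[symmetric]) fact+
    finally show "emeasure (area_measure W\<^sub>1 \<psi>\<^sub>1 J\<^sub>1) B = emeasure (area_measure W\<^sub>2 \<psi>\<^sub>2 J\<^sub>2) B" .
  qed
qed

lemma surface_measure_eq_area_measure:
  assumes "regular_parametrization W \<psi> J V"
  shows "surface_measure V = area_measure W \<psi> J"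
  unfolding surface_measure_def area_density_def[symmetric] area_measure_def[symmetric]
  by (rule the_equality) (use assms area_measure_unique in blast)+

text \<open>This avoids showing that \<open>V\<close> itself is a Borel set (the Lusin-Souslin theorem).\<close>

lemma borel_set_as_preimage:
  fixes \<psi> :: "'a::topological_space \<Rightarrow> 'b::topological_space"
  assumes h: "homeomorphism W V \<psi> \<phi>" and A: "A \<in> sets borel"
  obtains B where "B \<in> sets borel" "W \<inter> A = W \<inter> \<psi> -` B"
proof -
  have V: "continuous_on V \<phi>" "\<And>u. u \<in> W \<Longrightarrow> \<psi> u \<in> V" "\<And>u. u \<in> W \<Longrightarrow> \<phi> (\<psi> u) = u"
    using h by (auto simp: homeomorphism_def)
  have "\<phi> \<in> measurable (restrict_space borel V) borel"
    using V(1) by (rule borel_measurable_continuous_on_restrict)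
  from measurable_sets[OF this A] obtain B where B: "B \<in> sets borel" "\<phi> -` A \<inter> V = V \<inter> B"
    by (auto simp: sets_restrict_space space_restrict_space)
  have "W \<inter> A = W \<inter> \<psi> -` B"
    using B(2) V(2,3) by (auto simp: set_eq_iff) metis+
  with B(1) show thesis by (rule that)
qed

section \<open>Coordinates on the orbit space and the Jacobian matrix of the residuals\<close>

lemma mem_coord_domain_iff:
  "u \<in> coord_domain \<longleftrightarrow> - pi / 2 < u $ Inl 2 \<and> u $ Inl 2 < pi / 2 \<and> 0 \<le> u $ Inr 1"
  by (auto simp: coord_domain_def orbits_def attributables_def range_space_def orbit_chart_def attr_chart_def)

text \<open>The domain is not open at range zero, but from each of its points it contains a short
  segment in the positive direction of every coordinate axis, and these directions determine the
  derivative.\<close>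

lemma derivative_unique_within_coord_domain:
  fixes G :: "real^(4+2) \<Rightarrow> 'b::real_normed_vector"
  assumes "(G has_derivative D) (at u within coord_domain)" "(G has_derivative D') (at u within coord_domain)"
    and u: "u \<in> coord_domain"
  shows "D = D'"
proof (rule frechet_derivative_unique_within[OF assms(1,2)])
  fix i :: "real^(4+2)" and e :: real
  assume i: "i \<in> Basis" and e: "e > 0"
  from i obtain k where k: "i = axis k 1" by (auto simp: Basis_vec_def)
  \<comment> \<open>The declination is the only coordinate bounded above; moving by half of its
    remaining margin stays inside.\<close>
  define d where "d = min (e / 2) ((pi / 2 - u $ Inl 2) / 2)"
  have d: "0 < d" "d < e" "u $ Inl 2 + d < pi / 2"
    using u e by (auto simp: d_def mem_coord_domain_iff min_def field_simps)
  then have "u + d *\<^sub>R i \<in> coord_domain"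
    using u by (auto simp: k mem_coord_domain_iff axis_def)
  with d show "\<exists>d. 0 < \<bar>d\<bar> \<and> \<bar>d\<bar> < e \<and> u + d *\<^sub>R i \<in> coord_domain"
    by (intro exI[of _ d]) auto
qed

text \<open>The differences \<open>u' - u\<close> are multiples of 2 pi in the first coordinate, so
  these translations are the deck transformations of the covering map. They carry derivatives from
  one determination of the angle to another.\<close>

lemma orbit_chart_eq_translate:
  assumes eq: "orbit_chart u = orbit_chart u'"
  shows "orbit_chart (v + (u' - u)) = orbit_chart v"
proof -
  have *: "u' $ Inl i = u $ Inl i" if "i \<noteq> 1" for i
    using eq exhaust_4[of i] that by (auto simp: orbit_chart_def attr_chart_def)
  have **: "u' $ Inr j = u $ Inr j" for j
    using eq by (auto simp: orbit_chart_def vec_eq_iff)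
  have "cis (u $ Inl 1) = cis (u' $ Inl 1)"
    using eq by (auto simp: orbit_chart_def attr_chart_def)
  then obtain n :: int where "u' $ Inl 1 = u $ Inl 1 + 2 * pi * n"
    using sin_cos_eq_iff[of "u' $ Inl 1" "u $ Inl 1"] by (auto simp: complex_eq_iff)
  then have "cis (v $ Inl 1 + (u' $ Inl 1 - u $ Inl 1)) = cis (v $ Inl 1)"
    using sin_cos_eq_iff[of "v $ Inl 1 + (u' $ Inl 1 - u $ Inl 1)" "v $ Inl 1"] by (auto simp: complex_eq_iff)
  then show ?thesis by (simp add: orbit_chart_def attr_chart_def * **)
qed

text \<open>This justifies the description in \<open>jacobian\<close>: deck transformations carry
  the derivative at one determination to all the others, and uniqueness within
  \<open>coord_domain\<close> leaves a single matrix.\<close>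

lemma has_derivative_jacobian:
  assumes F: "C1_residuals F" and u: "u \<in> coord_domain"
  shows "((\<lambda>v. F (orbit_chart v)) has_derivative (\<lambda>h. jacobian F (orbit_chart u) *v h)) (at u within coord_domain)"
proof -
  let ?G = "\<lambda>v. F (orbit_chart v)"
  obtain D where D: "(?G has_derivative D) (at u within coord_domain)"
    using F u by (auto simp: C1_residuals_def differentiable_on_def differentiable_def)
  then have lin: "D = (\<lambda>h. matrix D *v h)" by (simp add: matrix_works has_derivative_linear)
  have "(?G has_derivative (\<lambda>h. matrix D *v h)) (at u' within coord_domain)"
    if eq: "orbit_chart u' = orbit_chart u" for u'
  proof -
    let ?t = "\<lambda>v. v + (u - u')"
    have t: "orbit_chart (?t v) = orbit_chart v" for v
      using orbit_chart_eq_translate[OF eq] .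
    then have "?t ` coord_domain \<subseteq> coord_domain" by (auto simp: coord_domain_def)
    then have "(?G has_derivative D) (at (?t u') within ?t ` coord_domain)"
      by (simp add: has_derivative_subset[OF D])
    moreover have "(?t has_derivative (\<lambda>h. h)) (at u' within coord_domain)"
      by (auto intro!: derivative_eq_intros)
    ultimately have "((?G \<circ> ?t) has_derivative (D \<circ> (\<lambda>h. h))) (at u' within coord_domain)"
      by (intro diff_chain_within)
    then show ?thesis using lin by (simp add: o_def t)
  qed
  moreover have "B = matrix D"
    if "\<forall>u'. orbit_chart u' = orbit_chart u \<longrightarrow> (?G has_derivative (\<lambda>h. B *v h)) (at u' within coord_domain)" for B
    using derivative_unique_within_coord_domain[OF D _ u, of "\<lambda>h. B *v h"] that lin
    by (auto simp: matrix_eq dest!: fun_cong)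
  ultimately have "\<exists>!B. \<forall>u'. orbit_chart u' = orbit_chart u \<longrightarrow>
      (?G has_derivative (\<lambda>h. B *v h)) (at u' within coord_domain)"
    by blast
  from theI'[OF this] show ?thesis by (auto simp: jacobian_def)
qed

section \<open>Gram matrices and the marginal normal matrix\<close>

lemma matrix_inv_unique:
  fixes A :: "real^'n^'n"
  assumes "A ** B = mat 1"
  shows "matrix_inv A = B"
proof -
  have BA: "B ** A = mat 1" using assms matrix_left_right_inverse by blast
  have "A ** matrix_inv A = mat 1 \<and> matrix_inv A ** A = mat 1"
    unfolding matrix_inv_def by (rule someI[of _ B]) (use assms BA in simp)
  then have "B ** A ** matrix_inv A = B" by (metis matrix_mul_assoc matrix_mul_rid)
  then show ?thesis by (simp add: BA)
qed

lemma matrix_inv_right: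
  fixes A :: "real^'n^'n"
  assumes "invertible A"
  shows "A ** matrix_inv A = mat 1"
  using assms matrix_inv_unique invertible_right_inverse by metis

lemma matrix_inv_left:
  fixes A :: "real^'n^'n"
  assumes "invertible A"
  shows "matrix_inv A ** A = mat 1"
  using matrix_inv_right[OF assms] matrix_left_right_inverse by blast

lemma invertible_gram_iff:
  fixes A :: "real^'n^'m"
  shows "invertible (transpose A ** A) \<longleftrightarrow> (\<forall>x. A *v x = 0 \<longrightarrow> x = 0)"
proof -
  have "(transpose A ** A) *v x = 0 \<longleftrightarrow> A *v x = 0" for x
  proof
    assume "(transpose A ** A) *v x = 0"
    then have "inner (transpose A *v (A *v x)) x = 0" by (simp add: matrix_vector_mul_assoc)
    then have "inner (A *v x) (A *v x) = 0" by (simp add: dot_lmul_matrix[symmetric] vector_transpose_matrix)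
    then show "A *v x = 0" by simp
  qed (simp add: matrix_vector_mul_assoc[symmetric])
  then show ?thesis by (simp add: invertible_left_inverse matrix_left_invertible_ker)
qed

lemma sum_UNIV_Plus:
  "(\<Sum>k\<in>(UNIV :: ('a::finite + 'b::finite) set). f k) = (\<Sum>i\<in>UNIV. f (Inl i)) + (\<Sum>j\<in>UNIV. f (Inr j))"
  by (simp add: UNIV_Plus_UNIV[symmetric] sum.Plus del: UNIV_Plus_UNIV)

lemma matrix_mul_minus_right: "A ** (- B) = - (A ** B :: real^'n^'m)"
  by (simp add: vec_eq_iff matrix_matrix_mult_def sum_negf)

lemma marginal_gram_matrix:
  fixes B :: "real^('a::finite + 'b::finite)^'m"
  defines "BA \<equiv> \<chi> k i. B $ k $ Inl i" and "BR \<equiv> \<chi> k j. B $ k $ Inr j"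
  assumes inv: "invertible (transpose B ** B)"
  defines "D \<equiv> - (matrix_inv (transpose BA ** BA) ** transpose BA ** BR)"
  defines "J \<equiv> BA ** D + BR"
  shows "(\<chi> i j. matrix_inv (transpose B ** B) $ Inr i $ Inr j) ** (transpose J ** J) = mat 1"
proof -
  let ?C = "transpose B ** B" and ?CA = "transpose BA ** BA"
  define E :: "real^'b^('a + 'b)" where
    "E = (\<chi> k j. case k of Inl i \<Rightarrow> D $ i $ j | Inr i \<Rightarrow> mat 1 $ i $ j)"
  have BE: "B ** E = J"
    by (simp add: vec_eq_iff matrix_matrix_mult_def sum_UNIV_Plus E_def J_def BA_def BR_def mat_def
        if_distrib sum.delta cong: if_cong)
  \<comment> \<open>Invertibility of the full normal matrix is inherited by its attributable block:
    padding \<open>x\<close> with zeros gives a vector \<open>y\<close> with the same image, and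
    \<open>B\<close> is injective.\<close>
  have "x = 0" if "BA *v x = 0" for x
  proof -
    define y :: "real^('a + 'b)" where "y = (\<chi> k. case k of Inl i \<Rightarrow> x $ i | Inr _ \<Rightarrow> 0)"
    have "B *v y = BA *v x"
      by (simp add: vec_eq_iff matrix_vector_mult_def sum_UNIV_Plus y_def BA_def)
    then have "y = 0" using inv that by (simp add: invertible_gram_iff)
    then have "y $ Inl i = 0" for i by simp
    then show "x = 0" by (simp add: y_def vec_eq_iff)
  qed
  then have "?CA ** matrix_inv ?CA = mat 1"
    by (intro matrix_inv_right) (simp add: invertible_gram_iff)
  \<comment> \<open>Normal equations: column by column, \<open>D\<close> solves the least squares
    problem for \<open>BA ** D = - BR\<close>, and \<open>J\<close> is the residual, orthogonal to
    the columns of \<open>BA\<close>.\<close>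
  then have "?CA ** D = - (transpose BA ** BR)"
    by (simp add: D_def matrix_mul_minus_right matrix_mul_assoc)
  then have ortho: "transpose BA ** J = 0"
    by (simp add: J_def matrix_add_ldistrib matrix_mul_assoc)
  define Z where "Z = transpose B ** J"
  have "Z $ Inl i $ j = (transpose BA ** J) $ i $ j" for i j
    by (simp add: Z_def matrix_matrix_mult_def transpose_def BA_def)
  then have Z0: "Z $ Inl i $ j = 0" for i j by (simp add: ortho)
  have "transpose J ** J = transpose E ** Z"
    by (simp add: Z_def BE[symmetric] matrix_transpose_mul matrix_mul_assoc)
  then have JJ: "(transpose J ** J) $ i $ j = Z $ Inr i $ j" for i j
    by (simp add: matrix_matrix_mult_def transpose_def sum_UNIV_Plus Z0 E_def mat_def
        if_distrib[of "\<lambda>x. x * _"] sum.delta cong: if_cong)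
  have "E = matrix_inv ?C ** ?C ** E"
    by (simp add: matrix_inv_left[OF inv])
  also have "\<dots> = matrix_inv ?C ** Z"
    by (simp add: Z_def BE[symmetric] matrix_mul_assoc)
  finally have "(matrix_inv ?C ** Z) $ Inr i $ j = mat 1 $ i $ j" for i j
    by (auto simp: E_def vec_eq_iff split: sum.splits)
  then show ?thesis
    by (simp add: vec_eq_iff matrix_matrix_mult_def[of "matrix_inv ?C"] sum_UNIV_Plus Z0 JJ
        matrix_matrix_mult_def[of "\<chi> i j. _ i j"])
qed

section \<open>Derivatives along the Manifold Of Variations\<close>

lemma f_mu_in_orbits:
  assumes "K \<subseteq> range_space" "\<rho> \<in> mov_domain F H a0 K"
  shows "f_mu F H a0 \<rho> \<in> orbits"
proof -
  obtain a where a: "dc_converges_to F H a0 \<rho> a" "local_minimiser F \<rho> a" "\<rho> \<in> K"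
    using assms(2) by (auto simp: mov_domain_def)
  then have "best_attr F H a0 \<rho> = a"
    unfolding best_attr_def by (intro limI) (simp add: dc_converges_to_def)
  then show ?thesis
    using a assms(1) by (auto simp: f_mu_def orbits_def local_minimiser_def)
qed

text \<open>The given lift agrees with \<open>A\<close> only near \<rho>. Cutting \<open>S\<close>
  down to a neighbourhood \<open>T\<close> makes it agree everywhere without changing the filter at
  \<rho>; the lift is then completed by the identity in the second component.\<close>

lemma lift_along_attr_derivative:
  assumes A: "has_attr_derivative A D \<rho> S" and "\<rho> \<in> S"
  obtains T U U' where "\<rho> \<in> T" "T \<subseteq> S" "at \<rho> within T = at \<rho> within S"
    "\<And>r. r \<in> T \<Longrightarrow> orbit_chart (U r) = (A r, r)"
    "(U has_derivative U') (at \<rho> within T)"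
    "\<And>h i. U' h $ Inl i = (D *v h) $ i" "\<And>h j. U' h $ Inr j = h $ j"
proof -
  obtain a where a: "attr_chart (a \<rho>) = A \<rho>" "\<forall>\<^sub>F r in at \<rho> within S. attr_chart (a r) = A r"
    "(a has_derivative (\<lambda>h. D *v h)) (at \<rho> within S)"
    using A by (auto simp: has_attr_derivative_def)
  obtain B where B: "open B" "\<rho> \<in> B" "\<And>r. r \<in> B \<Longrightarrow> r \<noteq> \<rho> \<Longrightarrow> r \<in> S \<Longrightarrow> attr_chart (a r) = A r"
    using a(2) unfolding eventually_at_topological by blast
  define U :: "real^2 \<Rightarrow> real^(4+2)" where "U r = (\<chi> k. case k of Inl i \<Rightarrow> a r $ i | Inr j \<Rightarrow> r $ j)" for r
  define U' :: "real^2 \<Rightarrow> real^(4+2)" where "U' h = (\<chi> k. case k of Inl i \<Rightarrow> (D *v h) $ i | Inr j \<Rightarrow> h $ j)" for h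
  have T: "at \<rho> within S \<inter> B = at \<rho> within S"
    using B by (intro at_within_nhd[of _ B]) auto
  show thesis
  proof (rule that)
    show "(U has_derivative U') (at \<rho> within S \<inter> B)"
      unfolding T
    proof (subst has_derivative_componentwise_within, rule ballI)
      fix b :: "real^(4+2)" assume "b \<in> Basis"
      then obtain k where k: "b = axis k 1" by (auto simp: Basis_vec_def)
      show "((\<lambda>r. inner (U r) b) has_derivative (\<lambda>h. inner (U' h) b)) (at \<rho> within S)"
      proof (cases k)
        case (Inl i)
        show ?thesis
          using has_derivative_inner_left[OF a(3), of "axis i 1"]
          by (simp add: k Inl U_def U'_def inner_axis inner_real_def)
      next
        case (Inr j)
        show ?thesis
          by (simp add: k Inr U_def U'_def inner_axis bounded_linear_imp_has_derivative bounded_linear_vec_nth)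
      qed
    qed
    show "orbit_chart (U r) = (A r, r)" if "r \<in> S \<inter> B" for r
      using that B a(1) by (cases "r = \<rho>") (auto simp: orbit_chart_def U_def)
  qed (use T B assms in \<open>auto simp: U'_def\<close>)
qed

lemma jacobian_mult_split:
  assumes "\<And>i. u $ Inl i = a $ i" "\<And>j. u $ Inr j = r $ j"
  shows "jacobian F x *v u = jacobian_attr F x *v a + jacobian_rho F x *v r"
  by (simp add: vec_eq_iff matrix_vector_mult_def sum_UNIV_Plus assms jacobian_attr_def jacobian_rho_def)

text \<open>Both claims are local at \<rho>, so composing with the local lift \<open>U\<close>
  suffices; \<open>orb\<close> keeps its image in \<open>coord_domain\<close>, the set relative to
  which \<open>F\<close> is differentiated.\<close>

lemma residuals_derivative_along:
  assumes F: "C1_residuals F" and A: "has_attr_derivative A D \<rho> S" and \<rho>: "\<rho> \<in> S"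
    and orb: "\<And>r. r \<in> S \<Longrightarrow> (A r, r) \<in> orbits"
  shows "((\<lambda>r. F (A r, r)) has_derivative
      (\<lambda>h. (jacobian_attr F (A \<rho>, \<rho>) ** D + jacobian_rho F (A \<rho>, \<rho>)) *v h)) (at \<rho> within S)"
    and "continuous (at \<rho> within S) (\<lambda>r. jacobian F (A r, r))"
proof -
  obtain T U U' where T: "\<rho> \<in> T" "T \<subseteq> S" "at \<rho> within T = at \<rho> within S"
    and U: "\<And>r. r \<in> T \<Longrightarrow> orbit_chart (U r) = (A r, r)"
    and dU: "(U has_derivative U') (at \<rho> within T)"
    and U': "\<And>h i. U' h $ Inl i = (D *v h) $ i" "\<And>h j. U' h $ Inr j = h $ j"
    by (rule lift_along_attr_derivative[OF A \<rho>]) (rule that)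
  have sub: "U ` T \<subseteq> coord_domain" using U orb T(2) by (auto simp: coord_domain_def)
  then have U\<rho>: "U \<rho> \<in> coord_domain" using T(1) by auto
  from has_derivative_jacobian[OF F this] have "((\<lambda>v. F (orbit_chart v)) has_derivative
      (\<lambda>h. jacobian F (A \<rho>, \<rho>) *v h)) (at (U \<rho>) within coord_domain)"
    by (simp add: U T(1))
  from diff_chain_within[OF dU has_derivative_subset[OF this sub]]
  have "((\<lambda>r. F (orbit_chart (U r))) has_derivative (\<lambda>h. jacobian F (A \<rho>, \<rho>) *v U' h)) (at \<rho> within T)"
    by (simp add: o_def)
  moreover have "jacobian F (A \<rho>, \<rho>) *v U' h =
      (jacobian_attr F (A \<rho>, \<rho>) ** D + jacobian_rho F (A \<rho>, \<rho>)) *v h" for h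
    using jacobian_mult_split[OF U']
    by (simp add: matrix_vector_mult_add_rdistrib matrix_vector_mul_assoc[symmetric])
  ultimately have "((\<lambda>r. F (orbit_chart (U r))) has_derivative
      (\<lambda>h. (jacobian_attr F (A \<rho>, \<rho>) ** D + jacobian_rho F (A \<rho>, \<rho>)) *v h)) (at \<rho> within T)"
    by simp
  from has_derivative_transform[OF T(1) _ this]
  show "((\<lambda>r. F (A r, r)) has_derivative
      (\<lambda>h. (jacobian_attr F (A \<rho>, \<rho>) ** D + jacobian_rho F (A \<rho>, \<rho>)) *v h)) (at \<rho> within S)"
    by (simp add: T(3) U)
  have "continuous_on coord_domain (\<lambda>u. jacobian F (orbit_chart u))"
    using F by (simp add: C1_residuals_def)
  then have "continuous (at (U \<rho>) within U ` T) (\<lambda>u. jacobian F (orbit_chart u))"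
    using U\<rho> sub continuous_on_eq_continuous_within continuous_within_subset by blast
  from continuous_within_compose[OF has_derivative_continuous[OF dU] this]
  have "continuous (at \<rho> within T) (\<lambda>r. jacobian F (orbit_chart (U r)))"
    by (simp add: o_def)
  then have "continuous (at \<rho> within T) (\<lambda>r. jacobian F (A r, r))"
    by (rule continuous_transform_within[OF _ zero_less_one T(1)]) (simp add: U)
  then show "continuous (at \<rho> within S) (\<lambda>r. jacobian F (A r, r))"
    by (simp add: continuous_within T(3))
qed

section \<open>Pulling back and normalising densities\<close>

text \<open>As \<psi> is a homeomorphism, each event about \<open>R\<close> is an event about
  \<open>\<psi> (R w)\<close> with a Borel set of the ambient space; its probability is an integral
  over the surface, which the parametrization turns into one over \<open>W\<close>.\<close>

lemma distributed_pullback: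
  assumes reg: "regular_parametrization W \<psi> J V"
    and R: "R \<in> borel_measurable M" "\<And>w. w \<in> space M \<Longrightarrow> R w \<in> W"
    and dist: "distributed M (surface_measure V) (\<lambda>w. \<psi> (R w)) p"
    and p: "p \<in> borel_measurable borel"
    and q: "q \<in> borel_measurable borel"
    and pq: "\<And>u. u \<in> W \<Longrightarrow> q u = ennreal (area_density J u) * p (\<psi> u)" "\<And>u. u \<notin> W \<Longrightarrow> q u = 0"
  shows "distributed M lborel R q"
  unfolding distributed_def
proof (intro conjI)
  obtain \<phi> where h: "homeomorphism W V \<psi> \<phi>" using reg by (auto simp: regular_parametrization_def)
  have W: "W \<in> sets borel" "continuous_on W \<psi>" "continuous_on W J"
    using reg h by (auto simp: regular_parametrization_def homeomorphism_def)
  note sm = surface_measure_eq_area_measure[OF reg]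
  show "distr M lborel R = density lborel q"
  proof (rule measure_eqI)
    fix A assume "A \<in> sets (distr M lborel R)"
    then have A: "A \<in> sets borel" by simp
    obtain B where B: "B \<in> sets borel" "W \<inter> A = W \<inter> \<psi> -` B"
      using borel_set_as_preimage[OF h A] .
    have mem: "u \<in> A \<longleftrightarrow> \<psi> u \<in> B" if "u \<in> W" for u using B(2) that by auto
    have "emeasure (distr M lborel R) A = emeasure M (R -` A \<inter> space M)"
      using R(1) A by (intro emeasure_distr) auto
    also have "R -` A \<inter> space M = (\<lambda>w. \<psi> (R w)) -` B \<inter> space M" using R(2) mem by auto
    also have "emeasure M \<dots> = (\<integral>\<^sup>+\<xi>. p \<xi> * indicator B \<xi> \<partial>surface_measure V)"
      using B(1) by (intro distributed_emeasure[OF dist]) (simp add: sm area_measure_def)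
    also have "\<dots> = (\<integral>\<^sup>+u\<in>W. ennreal (area_density J u) * (p (\<psi> u) * indicator B (\<psi> u)) \<partial>lborel)"
      unfolding sm using p B by (intro nn_integral_area_measure W) auto
    also have "\<dots> = (\<integral>\<^sup>+u. q u * indicator A u \<partial>lborel)"
      by (intro nn_integral_cong) (auto simp: pq mem indicator_def)
    also have "\<dots> = emeasure (density lborel q) A"
      using q A by (intro emeasure_density[symmetric]) auto
    finally show "emeasure (distr M lborel R) A = emeasure (density lborel q) A" .
  qed simp
qed (use q R in auto)

text \<open>Total mass one forces the value of \<open>a\<close>, and with it that the integral of
  \<open>w\<close> is finite and nonzero.\<close>

lemma distributed_normalised:
  fixes w :: "'b \<Rightarrow> real"
  assumes "prob_space M" and dist: "distributed M N X (\<lambda>x. ennreal (indicator W x * (a * w x)))"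
    and w: "(\<lambda>x. indicator W x * w x) \<in> borel_measurable N" "\<And>x. x \<in> W \<Longrightarrow> 0 \<le> w x"
  shows "distributed M N X (\<lambda>x. ennreal (indicator W x * (w x / (LINT r:W|N. w r))))"
proof -
  interpret prob_space M by fact
  let ?v = "\<lambda>x. indicator W x * w x"
  have v: "0 \<le> ?v x" for x using w(2) by (auto simp: indicator_def)
  have X: "X \<in> measurable M N" using dist by (simp add: distributed_def)
  have "(\<integral>\<^sup>+x. ennreal (indicator W x * (a * w x)) \<partial>N) =
      (\<integral>\<^sup>+x. ennreal (indicator W x * (a * w x)) * indicator (space N) x \<partial>N)"
    by (rule nn_integral_cong) simp
  also have "\<dots> = emeasure M (X -` space N \<inter> space M)"
    using distributed_emeasure[OF dist sets.top] by simp
  also have "X -` space N \<inter> space M = space M" using measurable_space[OF X] by auto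
  finally have one: "(\<integral>\<^sup>+x. ennreal (indicator W x * (a * w x)) \<partial>N) = 1"
    by (simp add: emeasure_space_1)
  \<comment> \<open>Otherwise \<open>ennreal\<close> would cut the density off to zero, and the
    total mass would vanish.\<close>
  have "a > 0"
  proof (rule ccontr)
    assume "\<not> a > 0"
    then have "indicator W x * (a * w x) \<le> 0" for x
      using w(2)[of x] by (auto simp: indicator_def mult_nonpos_nonneg)
    then show False using one by (simp add: ennreal_neg)
  qed
  have "1 = (\<integral>\<^sup>+x. ennreal a * ennreal (?v x) \<partial>N)"
    unfolding one[symmetric] using \<open>a > 0\<close> v by (simp add: ennreal_mult[symmetric] mult_ac)
  also have "\<dots> = ennreal a * (\<integral>\<^sup>+x. ennreal (?v x) \<partial>N)"
    using w(1) by (intro nn_integral_cmult) auto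
  finally have "1 = a * enn2real (\<integral>\<^sup>+x. ennreal (?v x) \<partial>N)"
    using \<open>a > 0\<close> by (metis enn2real_1 enn2real_ennreal enn2real_mult less_imp_le)
  \<comment> \<open>Both sides take the value 0 when the integral is infinite, so no prior
    integrability is required; the product being 1 excludes that case.\<close>
  also have "enn2real (\<integral>\<^sup>+x. ennreal (?v x) \<partial>N) = (LINT r:W|N. w r)"
    using w(1) v by (simp add: set_lebesgue_integral_def integral_eq_nn_integral)
  finally have "a = 1 / (LINT r:W|N. w r)" by (metis nonzero_eq_divide_eq mult_zero_right zero_neq_one)
  then show ?thesis using dist by (simp add: mult_ac)
qed

theorem theorem4p1:
  fixes F :: "orbit \<Rightarrow> real^'m"
    and H :: "orbit \<Rightarrow> real^4^4" and a0 :: "real^2 \<Rightarrow> attributable"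
    and AR K K' :: "(real^2) set" and f :: "real^2 \<Rightarrow> orbit"
    and dA :: "real^2 \<Rightarrow> real^2^4"
    and V :: "(real^'m) set" and Qstar c :: real
    and M :: "'w measure" and R :: "'w \<Rightarrow> real^2"
  defines "K' \<equiv> mov_domain F H a0 K"
    and "f \<equiv> f_mu F H a0"
    and "V \<equiv> F ` mov F H a0 K"
  assumes "CARD('m) \<ge> 6"
    and "C1_residuals F"
    and "compact AR" "AR \<subseteq> range_space" "K \<subseteq> AR"
    and "\<And>x. x \<in> mov F H a0 K \<Longrightarrow> invertible (normal_matrix F x)"
    and "Qstar \<in> (\<lambda>\<rho>. target_Q F (f \<rho>)) ` K'" "\<And>\<rho>. \<rho> \<in> K' \<Longrightarrow> Qstar \<le> target_Q F (f \<rho>)"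
    \<comment> \<open>\<open>f\<close> is of class C1, and the standing approximation for its derivative\<close>
    and "\<And>\<rho>. \<rho> \<in> K' \<Longrightarrow> has_attr_derivative (best_attr F H a0) (dA \<rho>) \<rho> K'"
    and "continuous_on K' dA"
    and "\<And>\<rho>. \<rho> \<in> K' \<Longrightarrow> dA \<rho> = - (matrix_inv (normal_matrix_attr F (f \<rho>))
           ** transpose (jacobian_attr F (f \<rho>)) ** jacobian_rho F (f \<rho>))"
    and "\<exists>J. regular_parametrization K' (\<lambda>\<rho>. F (f \<rho>)) J V"
    \<comment> \<open>\<open>R\<close> is the \<open>K'\<close>-valued variable whose image in \<open>V\<close> has density proportional to that of
       the residuals, with respect to the surface measure of \<open>V\<close>\<close>
    and "prob_space M" "R \<in> borel_measurable M" "\<And>w. w \<in> space M \<Longrightarrow> R w \<in> K'"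
    and "distributed M (surface_measure V) (\<lambda>w. F (f (R w))) (\<lambda>\<xi>. ennreal (c * p_Xi \<xi>))"
  shows "distributed M lborel R (\<lambda>\<rho>. ennreal (indicator K' \<rho> *
           (exp (- chi_sq F f Qstar \<rho> / 2) * sqrt (det (marginal_normal_matrix F (f \<rho>))) /
            (LINT r:K'|lborel. exp (- chi_sq F f Qstar r / 2)
                               * sqrt (det (marginal_normal_matrix F (f r)))))))"
proof -
  note C1 = \<open>C1_residuals F\<close> and dA_eq = assms(14)
  define J where "J \<rho> = jacobian_attr F (f \<rho>) ** dA \<rho> + jacobian_rho F (f \<rho>)" for \<rho>
  define w where "w = (\<lambda>\<rho>. exp (- chi_sq F f Qstar \<rho> / 2) * sqrt (det (marginal_normal_matrix F (f \<rho>))))"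
  have f_eq: "f r = (best_attr F H a0 r, r)" for r by (simp add: f_def f_mu_def)
  have orb: "(best_attr F H a0 r, r) \<in> orbits" if "r \<in> K'" for r
    using f_mu_in_orbits[of K r F H a0] that assms(7,8) by (auto simp: K'_def f_mu_def)
  have derF: "((\<lambda>\<rho>. F (f \<rho>)) has_derivative (\<lambda>h. J \<rho> *v h)) (at \<rho> within K')" if "\<rho> \<in> K'" for \<rho>
    using residuals_derivative_along(1)[OF C1 assms(12)[OF that] that orb] by (simp add: J_def f_eq)
  have "continuous_on K' (\<lambda>\<rho>. jacobian F (f \<rho>))"
    unfolding continuous_on_eq_continuous_within
    using residuals_derivative_along(2)[OF C1 assms(12) _ orb] by (simp add: f_eq)
  then have contJ: "continuous_on K' J"
    unfolding J_def jacobian_attr_def jacobian_rho_def matrix_matrix_mult_def vec_lambda_beta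
    using assms(13) by (intro continuous_intros)
  have marginal: "marginal_normal_matrix F (f \<rho>) = transpose (J \<rho>) ** J \<rho>"
    and rankJ: "rank (J \<rho>) = 2" if "\<rho> \<in> K'" for \<rho>
  proof -
    have "invertible (normal_matrix F (f \<rho>))"
      using assms(9) that by (simp add: mov_def f_def K'_def)
    then have *: "covariance_rho F (f \<rho>) ** (transpose (J \<rho>) ** J \<rho>) = mat 1"
      using marginal_gram_matrix[of "jacobian F (f \<rho>)"] dA_eq[OF that]
      by (simp add: covariance_rho_def covariance_def normal_matrix_def normal_matrix_attr_def
          jacobian_attr_def jacobian_rho_def J_def)
    then show "marginal_normal_matrix F (f \<rho>) = transpose (J \<rho>) ** J \<rho>"
      unfolding marginal_normal_matrix_def by (rule matrix_inv_unique)
    from * have "invertible (transpose (J \<rho>) ** J \<rho>)" by (auto simp: invertible_left_inverse)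
    then have "inj ((*v) (J \<rho>))"
      unfolding invertible_gram_iff matrix_left_invertible_ker[symmetric] matrix_left_invertible_injective .
    then show "rank (J \<rho>) = 2" using full_rank_injective[of "J \<rho>"] by simp
  qed
  \<comment> \<open>The hypothesis contributes the Borel domain and the homeomorphism; the Jacobian
    matrix is exchanged for the one from the chain rule, whose Gram matrix is known.\<close>
  have reg: "regular_parametrization K' (\<lambda>\<rho>. F (f \<rho>)) J V"
    using assms(15) contJ derF rankJ by (auto simp: regular_parametrization_def)
  then have K': "K' \<in> sets borel" and contF: "continuous_on K' (\<lambda>\<rho>. F (f \<rho>))"
    by (auto simp: regular_parametrization_def homeomorphism_def)
  have w_eq: "w \<rho> = exp (- chi_sq F f Qstar \<rho> / 2) * area_density J \<rho>" if "\<rho> \<in> K'" for \<rho>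
    by (simp add: w_def area_density_def marginal[OF that])
  have chi: "chi_sq F f Qstar \<rho> = inner (F (f \<rho>)) (F (f \<rho>)) - CARD('m) * Qstar" for \<rho>
    by (simp add: chi_sq_def target_Q_def field_simps)
  have "continuous_on K' (\<lambda>\<rho>. exp (- chi_sq F f Qstar \<rho> / 2) * area_density J \<rho>)"
    unfolding chi by (intro continuous_intros contF continuous_on_area_density contJ) simp
  then have "continuous_on K' w" by (simp add: w_eq cong: continuous_on_cong)
  from borel_measurable_continuous_on_indicator[OF K' this]
  have w: "(\<lambda>\<rho>. indicator K' \<rho> * w \<rho>) \<in> borel_measurable borel" by simp
  \<comment> \<open>The squared norm of the residuals exceeds chi squared by
    \<open>CARD('m) * Qstar\<close>, a constant that moves into \<open>k\<close>.\<close>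
  define k where "k = (2 * pi) powr (- real CARD('m) / 2) * exp (- (CARD('m) * Qstar) / 2)"
  have p_Xi: "p_Xi (F (f \<rho>)) = k * exp (- chi_sq F f Qstar \<rho> / 2)" for \<rho>
    by (simp add: p_Xi_def k_def chi exp_add[symmetric] diff_divide_distrib)
  have "distributed M lborel R (\<lambda>\<rho>. ennreal (indicator K' \<rho> * ((c * k) * w \<rho>)))"
  proof (rule distributed_pullback[OF reg assms(17,18,19)])
    show "(\<lambda>\<xi>. ennreal (c * p_Xi \<xi>)) \<in> borel_measurable borel"
      unfolding p_Xi_def by measurable
    have "(\<lambda>\<rho>. ennreal ((c * k) * (indicator K' \<rho> * w \<rho>))) \<in> borel_measurable borel"
      using w by measurable
    then show "(\<lambda>\<rho>. ennreal (indicator K' \<rho> * ((c * k) * w \<rho>))) \<in> borel_measurable borel"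
      by (simp add: mult_ac)
    show "ennreal (indicator K' \<rho> * ((c * k) * w \<rho>)) = ennreal (area_density J \<rho>) * ennreal (c * p_Xi (F (f \<rho>)))"
      if "\<rho> \<in> K'" for \<rho>
      using that by (simp add: ennreal_mult'[symmetric] area_density_nonneg p_Xi w_eq mult_ac)
  qed auto
  then have "distributed M lborel R (\<lambda>\<rho>. ennreal (indicator K' \<rho> * (w \<rho> / (LINT r:K'|lborel. w r))))"
    using w by (intro distributed_normalised[OF \<open>prob_space M\<close>]) (auto simp: w_eq area_density_nonneg)
  then show ?thesis unfolding w_def .
qed

end
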